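(* Let $K_+\in\mathfrak{u}_\perp(N)$ in the bosonic case, or $K_+\in\mathcal{I}_{\mathfrak{u}_\perp(N)}$ in the fermionic case. Then $\cosh K_+$ commutes with $J$, and $\overline{\det}(\cosh K_+)=\sqrt{\det(\cosh K_+)}>0$.
   Context: Bosonic case: $\mathfrak{g}=\mathfrak{sp}(2N,\mathbb{R})=\{K:K\Omega=-\Omega K^\intercal\}$ with $\Omega=\begin{pmatrix}0&\mathbb{1}\\-\mathbb{1}&0\end{pmatrix}$, and $J$ a complex structure with $J\Omega J^\intercal=\Omega$, $-J\Omega>0$. Fermionic case: $\mathfrak{g}=\mathfrak{so}(2N,\mathbb{R})$, $J$ orthogonal with $J^2=-\mathbb{1}$. $\mathfrak{u}_\perp(N)=\{K_+\in\mathfrak{g}:K_+J=-JK_+\}$ and $\mathcal{I}_{\mathfrak{u}_\perp(N)}=\{K_+\in\mathfrak{u}_\perp(N):$ all eigenvalues of $K_+$ have modulus $<\pi/2\}$. For $A$ commuting with $J$, written as $\begin{pmatrix}A_1&A_2\\-A_2&A_1\end{pmatrix}$ in a basis where $J=\begin{pmatrix}0&\mathbb{1}\\-\mathbb{1}&0\end{pmatrix}$, $\overline{\det}(A)=\det(A_1+\mathrm{i}A_2)$. *)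

theory Defs
  imports "HOL-Analysis.Analysis"
begin

text \<open>Real 2N x 2N matrices are indexed by the type 'n + 'n (CARD('n) = N):
  Inl i is the i-th coordinate of the first block, Inr i of the second block.\<close>

type_synonym 'n rmat2 = "real ^ ('n + 'n) ^ ('n + 'n)"

text \<open>The standard block matrix ((0, 1), (-1, 0)); used both for Omega and for J in the
  adapted basis.\<close>
definition std_block :: "'n::finite rmat2" where
  "std_block = (\<chi> i j. (case (i, j) of
      (Inl a, Inr b) \<Rightarrow> (if a = b then 1 else 0)
    | (Inr a, Inl b) \<Rightarrow> (if a = b then -1 else 0)
    | _ \<Rightarrow> 0))"

abbreviation Omega :: "'n::finite rmat2" where "Omega \<equiv> std_block"

primrec mpow :: "'a::{comm_ring_1} ^ 'm ^ 'm \<Rightarrow> nat \<Rightarrow> 'a ^ 'm ^ 'm" where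
  "mpow A 0 = mat 1"
| "mpow A (Suc k) = A ** mpow A k"

text \<open>Matrix hyperbolic cosine via its power series.\<close>
definition mcosh :: "real ^ 'm ^ 'm \<Rightarrow> real ^ 'm ^ 'm" where
  "mcosh K = (\<Sum>k. (1 / fact (2 * k)) *\<^sub>R mpow K (2 * k))"

text \<open>Lie algebras.\<close>
definition sp_alg :: "'n::finite rmat2 set" where
  "sp_alg = {K. K ** Omega = - (Omega ** transpose K)}"

definition so_alg :: "(real ^ 'm ^ 'm) set" where
  "so_alg = {K. transpose K = - K}"

text \<open>u_perp(N) inside a Lie algebra g: elements anticommuting with J.\<close>
definition u_perp :: "(real ^ 'm ^ 'm) set \<Rightarrow> real ^ 'm ^ 'm \<Rightarrow> (real ^ 'm ^ 'm) set" where
  "u_perp g J = {K \<in> g. K ** J = - (J ** K)}"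

text \<open>Complex eigenvalues of a real square matrix.\<close>
definition cmat :: "real ^ 'm ^ 'm \<Rightarrow> complex ^ 'm ^ 'm" where
  "cmat A = (\<chi> i j. complex_of_real (A $ i $ j))"

definition eigenvalues :: "real ^ 'm ^ 'm \<Rightarrow> complex set" where
  "eigenvalues A = {c. det (mat c - cmat A) = 0}"

text \<open>I_{u_perp(N)}: elements of u_perp(N) all of whose eigenvalues have modulus < pi/2.\<close>
definition I_u_perp :: "(real ^ 'm ^ 'm) set \<Rightarrow> real ^ 'm ^ 'm \<Rightarrow> (real ^ 'm ^ 'm) set" where
  "I_u_perp g J = {K \<in> u_perp g J. \<forall>c \<in> eigenvalues K. cmod c < pi / 2}"

text \<open>Bosonic complex structure: J^2 = -1, J Omega J^T = Omega, -J Omega positive definite.\<close>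
definition bosonic_cs :: "'n::finite rmat2 \<Rightarrow> bool" where
  "bosonic_cs J \<longleftrightarrow> J ** J = - mat 1 \<and> J ** Omega ** transpose J = Omega \<and>
     (\<forall>v. v \<noteq> 0 \<longrightarrow> v \<bullet> ((- (J ** Omega)) *v v) > 0)"

text \<open>Fermionic complex structure: J orthogonal with J^2 = -1.\<close>
definition fermionic_cs :: "'n::finite rmat2 \<Rightarrow> bool" where
  "fermionic_cs J \<longleftrightarrow> transpose J ** J = mat 1 \<and> J ** J = - mat 1"

text \<open>detbar: for A commuting with J, write A in a basis in which J becomes the standard
  block matrix ((0,1),(-1,0)); then A = ((A1, A2), (-A2, A1)) and detbar A = det (A1 + i A2).
  The basis change S (new coordinates = S old coordinates) is chosen by Hilbert choice.\<close>
definition detbar :: "'n::finite rmat2 \<Rightarrow> 'n rmat2 \<Rightarrow> complex" where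
  "detbar J A = (let S = (SOME S. invertible S \<and> S ** J ** matrix_inv S = std_block);
                     B = S ** A ** matrix_inv S
                 in det ((\<chi> i j. complex_of_real (B $ Inl i $ Inl j)
                                 + \<i> * complex_of_real (B $ Inl i $ Inr j)) :: complex ^ 'n ^ 'n))"

end

theory Submission
  imports Defs
begin

(*
  Since K anticommutes with J, K^2 and hence cosh K commute with J. In a basis adapted to J, a
  matrix B commuting with J is the realification of the complex matrix b = B1 + i B2, and its
  complexification is similar to diag (conj b, b), so det B = |det b|^2. If B is moreover
  self-adjoint and positive definite for a J-invariant inner product G, then b is self-adjoint
  for the induced Hermitian form, so det b is real. Every point of the segment from 1 to B has
  the same properties, so det b, followed along the segment, is real, never zero and starts at 1:
  it is positive.

  For cosh K such a G exists. In the bosonic case G = -Omega J, and each term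
  G K^(2k) = (K^k)^T G K^k of the series is positive semidefinite. In the fermionic case G = 1:
  an eigenvector of K^T K = -K^2 with eigenvalue s^2 is an eigenvector of cosh K with eigenvalue
  cos s, and i s or -i s is an eigenvalue of K, so s < pi/2 and cos s > 0; diagonalising the
  symmetric matrix K^T K gives positivity.
*)

section \<open>Matrix algebra\<close>

lemma matrix_mult_uminus_left: "(- A) ** B = - (A ** (B :: 'a::ring_1^'n^'k))"
  by (simp add: vec_eq_iff matrix_matrix_mult_def sum_negf)

lemma matrix_mult_uminus_right: "A ** (- B) = - ((A :: 'a::ring_1^'k^'m) ** B)"
  by (simp add: vec_eq_iff matrix_matrix_mult_def sum_negf)

lemma matrix_add_rdistrib: "(A + B) ** C = A ** C + B ** (C :: 'a::semiring_1^'n^'k)"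
  by (simp add: vec_eq_iff matrix_matrix_mult_def sum.distrib distrib_right)

lemma matrix_vector_mult_uminus_left: "(- A) *v v = - (A *v (v :: 'a::ring_1^'n))"
  by (simp add: vec_eq_iff matrix_vector_mult_def sum_negf)

lemma transpose_add: "transpose (A + B) = transpose A + transpose (B :: 'a::semiring_1^'n^'m)"
  by (simp add: vec_eq_iff transpose_def)

lemma inner_transpose_matrix_vector: "x \<bullet> (transpose A *v y) = (A *v x) \<bullet> (y :: real^'n)"
  by (metis dot_lmul_matrix vector_transpose_matrix)

lemma det_eq_0_iff_kernel:
  fixes A :: "'a::field^'n^'n"
  shows "det A = 0 \<longleftrightarrow> (\<exists>x. x \<noteq> 0 \<and> A *v x = 0)"
  by (metis invertible_det_nz invertible_left_inverse matrix_left_invertible_ker)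

lemma matrix_inv_right: "invertible A \<Longrightarrow> A ** matrix_inv A = mat 1"
  and matrix_inv_left: "invertible A \<Longrightarrow> matrix_inv A ** A = mat 1"
  using someI_ex[of "\<lambda>B. A ** B = mat 1 \<and> B ** A = mat 1"]
  by (auto simp: invertible_def matrix_inv_def)

lemma matrix_inv_unique:
  assumes "A ** B = mat 1" and "B ** A = mat (1::'a::comm_semiring_1)"
  shows "matrix_inv A = B"
proof -
  have "invertible A" using assms by (auto simp: invertible_def)
  then have "matrix_inv A = (B ** A) ** matrix_inv A" using assms(2) by simp
  also have "\<dots> = B" using matrix_inv_right[OF \<open>invertible A\<close>] by (simp flip: matrix_mul_assoc)
  finally show ?thesis .
qed

definition pos_def :: "real^'n^'n \<Rightarrow> bool" where
  "pos_def A \<longleftrightarrow> (\<forall>v. v \<noteq> 0 \<longrightarrow> 0 < v \<bullet> (A *v v))"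

lemma pos_def_det_nonzero: "pos_def A \<Longrightarrow> det A \<noteq> 0"
  unfolding pos_def_def det_eq_0_iff_kernel by (metis inner_zero_right less_irrefl)

lemma pos_def_congruence:
  fixes G :: "real^'n^'n" and P :: "real^'m^'n"
  assumes "pos_def G" and "Q ** P = mat 1"
  shows "pos_def (transpose P ** G ** P)"
  unfolding pos_def_def
proof (intro allI impI)
  fix v :: "real^'m" assume "v \<noteq> 0"
  then have "P *v v \<noteq> 0"
    using assms(2) by (metis matrix_vector_mul_assoc matrix_vector_mul_lid matrix_vector_mult_0_right)
  then have "0 < (P *v v) \<bullet> (G *v (P *v v))"
    using assms(1) by (simp add: pos_def_def)
  then show "0 < v \<bullet> ((transpose P ** G ** P) *v v)"
    by (simp only: inner_transpose_matrix_vector flip: matrix_vector_mul_assoc)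
qed

lemma pos_def_right_inverse:
  fixes A B :: "real^'n^'n"
  assumes "pos_def A" and "A ** B = mat 1"
  shows "pos_def B"
  unfolding pos_def_def
proof (intro allI impI)
  fix v :: "real^'n" assume "v \<noteq> 0"
  have "A *v (B *v v) = v"
    using assms(2) by (simp add: matrix_vector_mul_assoc)
  then have "B *v v \<noteq> 0"
    using \<open>v \<noteq> 0\<close> by auto
  then have "0 < (B *v v) \<bullet> (A *v (B *v v))"
    using assms(1) by (simp add: pos_def_def)
  then show "0 < v \<bullet> (B *v v)"
    using \<open>A *v (B *v v) = v\<close> by (simp add: inner_commute)
qed

section \<open>Matrix powers and the hyperbolic cosine\<close>

lemma mpow_Suc_right: "mpow A (Suc k) = mpow A k ** A"
  by (induction k) (simp_all add: matrix_mul_assoc)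

lemma mpow_add: "mpow A (m + n) = mpow A m ** mpow A n"
  by (induction m) (simp_all add: matrix_mul_assoc)

lemma mpow_mult2: "mpow A (2 * k) = mpow (A ** A) k"
  by (induction k) (simp_all add: matrix_mul_assoc mpow_Suc_right)

lemma mpow_intertwine:
  assumes "X ** A = B ** X"
  shows "X ** mpow A k = mpow B k ** X"
proof (induction k)
  case (Suc k)
  have "X ** mpow A (Suc k) = B ** (X ** mpow A k)"
    using assms by (simp add: matrix_mul_assoc)
  with Suc show ?case by (simp add: matrix_mul_assoc)
qed simp

lemma mpow_transpose: "transpose (mpow A k) = mpow (transpose A) k"
proof (induction k)
  case (Suc k)
  then show ?case by (simp add: matrix_transpose_mul flip: mpow_Suc_right)
qed simp

lemma onorm_mpow_le:
  fixes A :: "real^'m^'m"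
  shows "onorm ((*v) (mpow A k)) \<le> onorm ((*v) A) ^ k"
proof (induction k)
  case 0
  have "(*v) (mat 1 :: real^'m^'m) = (\<lambda>x. x)" by auto
  then show ?case using onorm_id_le by simp
next
  case (Suc k)
  have "(*v) (mpow A (Suc k)) = (*v) A \<circ> (*v) (mpow A k)"
    by (simp add: fun_eq_iff matrix_vector_mul_assoc)
  then have "onorm ((*v) (mpow A (Suc k))) \<le> onorm ((*v) A) * onorm ((*v) (mpow A k))"
    by (simp add: onorm_compose matrix_vector_mul_bounded_linear)
  also have "\<dots> \<le> onorm ((*v) A) ^ Suc k"
    using Suc by (simp add: mult_left_mono onorm_pos_le matrix_vector_mul_bounded_linear)
  finally show ?case .
qed

lemma norm_matrix_le_onorm:
  fixes A :: "real^'n^'m"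
  shows "norm A \<le> real CARD('m) * real CARD('n) * onorm ((*v) A)"
proof -
  have "norm A \<le> (\<Sum>i\<in>UNIV. norm (A $ i))"
    unfolding norm_vec_def by (rule L2_set_le_sum) simp
  also have "\<dots> \<le> (\<Sum>i\<in>UNIV. \<Sum>j\<in>UNIV. \<bar>A $ i $ j\<bar>)"
    by (intro sum_mono norm_le_l1_cart)
  also have "\<dots> \<le> (\<Sum>i\<in>(UNIV::'m set). \<Sum>j\<in>(UNIV::'n set). onorm ((*v) A))"
    by (intro sum_mono matrix_component_le_onorm)
  finally show ?thesis by simp
qed

lemma summable_mcosh: "summable (\<lambda>k. (1 / fact (2 * k)) *\<^sub>R mpow (K::real^'m^'m) (2 * k))"
proof (rule summable_comparison_test')
  let ?c = "real CARD('m) * real CARD('m)" and ?a = "onorm ((*v) K)"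
  show "summable (\<lambda>k. ?c * (inverse (fact k) * ?a ^ (2 * k)))"
    unfolding power_mult by (intro summable_mult summable_exp)
  fix k :: nat
  have "norm (mpow K (2 * k)) \<le> ?c * ?a ^ (2 * k)"
    by (rule order_trans[OF norm_matrix_le_onorm]) (simp add: mult_left_mono onorm_mpow_le)
  then have "norm ((1 / fact (2 * k)) *\<^sub>R mpow K (2 * k)) \<le> (1 / fact (2 * k)) * (?c * ?a ^ (2 * k))"
    by (simp add: divide_right_mono)
  also have "\<dots> \<le> (1 / fact k) * (?c * ?a ^ (2 * k))"
    by (intro mult_right_mono divide_left_mono) (auto simp: fact_mono onorm_pos_le matrix_vector_mul_bounded_linear)
  finally show "norm ((1 / fact (2 * k)) *\<^sub>R mpow K (2 * k)) \<le> ?c * (inverse (fact k) * ?a ^ (2 * k))"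
    by (simp add: divide_inverse mult_ac)
qed

lemma sums_mcosh: "(\<lambda>k. (1 / fact (2 * k)) *\<^sub>R mpow K (2 * k)) sums mcosh K"
  unfolding mcosh_def by (rule summable_sums[OF summable_mcosh])

lemma linear_sums_mcosh:
  fixes L :: "real^'m^'m \<Rightarrow> 'b::real_normed_vector"
  assumes "linear L"
  shows "(\<lambda>k. (1 / fact (2 * k)) *\<^sub>R L (mpow K (2 * k))) sums L (mcosh K)"
proof -
  have "bounded_linear L" using assms by (simp add: linear_conv_bounded_linear)
  from bounded_linear.sums[OF this sums_mcosh[of K]] show ?thesis
    using assms by (simp add: linear_scale)
qed

lemma linear_matrix_mult_left: "linear (\<lambda>X::real^'n^'m. M ** X)"
  by (rule linearI) (simp_all add: matrix_add_ldistrib matrix_scalar_ac scalar_matrix_assoc)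

lemma linear_matrix_mult_right: "linear (\<lambda>X::real^'m^'k. X ** M)"
  by (rule linearI) (simp_all add: matrix_add_rdistrib scalar_matrix_assoc)

lemma mcosh_intertwine:
  assumes "X ** (A ** A) = (B ** B) ** X"
  shows "X ** mcosh A = mcosh B ** X"
proof -
  have "X ** mpow A (2 * k) = mpow B (2 * k) ** X" for k
    using mpow_intertwine[OF assms] by (simp add: mpow_mult2)
  then show ?thesis
    using linear_sums_mcosh[OF linear_matrix_mult_left[of X], of A]
      linear_sums_mcosh[OF linear_matrix_mult_right[of X], of B]
    by (simp add: sums_unique2)
qed

lemma mcosh_transpose: "transpose (mcosh A) = mcosh (transpose A)"
proof -
  have "linear (transpose :: real^'m^'m \<Rightarrow> real^'m^'m)"
    by (rule linearI) (simp_all add: transpose_add transpose_scalar)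
  from linear_sums_mcosh[OF this, of A] show ?thesis
    using sums_mcosh[of "transpose A"] by (simp add: mpow_transpose sums_unique2)
qed

lemma mcosh_adjoint:
  assumes "H ** K = transpose K ** H"
  shows "H ** mcosh K = transpose (mcosh K) ** H"
proof -
  have "H ** (K ** K) = (transpose K ** transpose K) ** H"
    using assms by (metis matrix_mul_assoc)
  then show ?thesis
    by (simp add: mcosh_intertwine mcosh_transpose)
qed

lemma mcosh_commute_if_anticommute:
  assumes "K ** J = - (J ** K)"
  shows "mcosh K ** J = J ** mcosh K"
proof -
  have "J ** (K ** K) = (J ** K) ** K"
    by (simp add: matrix_mul_assoc)
  also have "\<dots> = - (K ** (J ** K))"
    using assms by (simp add: matrix_mult_uminus_left matrix_mul_assoc)
  also have "\<dots> = (K ** K) ** J"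
    using assms by (simp add: matrix_mult_uminus_right flip: matrix_mul_assoc)
  finally show ?thesis
    by (simp add: mcosh_intertwine)
qed

lemma mcosh_uminus: "mcosh (- A) = mcosh A"
  by (simp add: mcosh_def mpow_mult2 matrix_mult_uminus_left matrix_mult_uminus_right)

lemma mcosh_eigenvector:
  fixes K :: "real^'m^'m"
  assumes "(K ** K) *v w = (- (s\<^sup>2)) *\<^sub>R w"
  shows "mcosh K *v w = cos s *\<^sub>R w"
proof -
  have "K *v (K *v w) = (- (s\<^sup>2)) *\<^sub>R w"
    using assms by (simp add: matrix_vector_mul_assoc)
  then have "mpow (K ** K) k *v w = (- (s\<^sup>2)) ^ k *\<^sub>R w" for k
    by (induction k) (simp_all add: matrix_vector_mult_scaleR flip: matrix_vector_mul_assoc)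
  then have "(1 / fact (2 * k)) *\<^sub>R (mpow K (2 * k) *v w) = ((- 1) ^ k / fact (2 * k) * s ^ (2 * k)) *\<^sub>R w"
    for k by (simp add: mpow_mult2 power_mult power_minus[of "s\<^sup>2"])
  moreover have "linear (\<lambda>X::real^'m^'m. X *v w)"
    by (rule linearI) (simp_all add: matrix_vector_mult_add_rdistrib scaleR_matrix_vector_assoc)
  ultimately show ?thesis
    using linear_sums_mcosh[of "\<lambda>X. X *v w" K] sums_scaleR_left[OF cos_paired[of s], of w]
    by (simp add: sums_unique2)
qed

lemma pos_def_mult_mcosh:
  fixes H K :: "real^'m^'m"
  assumes H: "pos_def H" and HK: "H ** K = transpose K ** H"
  shows "pos_def (H ** mcosh K)"
  unfolding pos_def_def
proof (intro allI impI)
  fix v :: "real^'m"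
  assume "v \<noteq> 0"
  let ?t = "\<lambda>k. (1 / fact (2 * k)) *\<^sub>R (v \<bullet> ((H ** mpow K (2 * k)) *v v))"
  have "linear (\<lambda>X. v \<bullet> ((H ** X) *v v))"
    by (rule linearI) (simp_all add: matrix_add_ldistrib matrix_vector_mult_add_rdistrib inner_add_right
        matrix_scalar_ac scalar_matrix_assoc[symmetric] scaleR_matrix_vector_assoc[symmetric])
  then have sums: "?t sums (v \<bullet> ((H ** mcosh K) *v v))"
    by (rule linear_sums_mcosh)
  \<comment> \<open>each term is a value of the quadratic form of \<open>H\<close>, at the vector \<open>K\<^sup>k v\<close>\<close>
  have "v \<bullet> ((H ** mpow K (2 * k)) *v v) = (mpow K k *v v) \<bullet> (H *v (mpow K k *v v))" for k
  proof -
    have "H ** mpow K (2 * k) = transpose (mpow K k) ** H ** mpow K k"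
      using mpow_intertwine[OF HK, of k]
      by (simp add: mult_2 mpow_add matrix_mul_assoc mpow_transpose)
    then show ?thesis by (simp only: inner_transpose_matrix_vector flip: matrix_vector_mul_assoc)
  qed
  then have nonneg: "0 \<le> ?t k" for k
    using H by (cases "mpow K k *v v = 0") (simp_all add: pos_def_def less_imp_le)
  have "0 < ?t 0"
    using H \<open>v \<noteq> 0\<close> by (simp add: pos_def_def)
  from suminf_pos2[OF sums_summable[OF sums] nonneg this]
  show "0 < v \<bullet> ((H ** mcosh K) *v v)"
    using sums_unique[OF sums] by simp
qed

section \<open>Matrices commuting with the standard complex structure\<close>

lemma sum_UNIV_Plus:
  fixes f :: "'a::finite + 'b::finite \<Rightarrow> 'c::comm_monoid_add"
  shows "(\<Sum>k\<in>UNIV. f k) = (\<Sum>i\<in>UNIV. f (Inl i)) + (\<Sum>i\<in>UNIV. f (Inr i))"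
  using sum.Plus[of "UNIV::'a set" "UNIV::'b set" f] by (simp add: o_def)

lemma std_block_nth [simp]:
  "std_block $ Inl a $ Inl b = 0" "std_block $ Inl a $ Inr b = (if a = b then 1 else 0)"
  "std_block $ Inr a $ Inl b = (if a = b then -1 else 0)" "std_block $ Inr a $ Inr b = 0"
  by (simp_all add: std_block_def)

lemma matrix_mult_std_block_nth:
  fixes B :: "'n::finite rmat2"
  shows "(B ** std_block) $ x $ Inl b = - B $ x $ Inr b"
    and "(B ** std_block) $ x $ Inr b = B $ x $ Inl b"
  by (simp_all add: matrix_matrix_mult_def sum_UNIV_Plus if_distrib cong: if_cong)

lemma std_block_matrix_mult_nth:
  fixes B :: "'n::finite rmat2"
  shows "(std_block ** B) $ Inl a $ y = B $ Inr a $ y"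
    and "(std_block ** B) $ Inr a $ y = - B $ Inl a $ y"
  by (simp_all add: matrix_matrix_mult_def sum_UNIV_Plus if_distrib[of "\<lambda>x. x * c" for c] cong: if_cong)

lemma transpose_std_block: "transpose (std_block :: 'n::finite rmat2) = - std_block"
  by (simp add: vec_eq_iff transpose_def std_block_def split: sum.splits)

lemma std_block_squared: "(std_block :: 'n::finite rmat2) ** std_block = - mat 1"
  unfolding vec_eq_iff
proof (intro allI)
  fix x y :: "'n + 'n"
  show "(std_block ** std_block) $ x $ y = (- mat 1 :: 'n rmat2) $ x $ y"
    by (cases x; cases y) (simp_all add: matrix_mult_std_block_nth mat_def)
qed

lemma commute_std_block_iff:
  "B ** std_block = std_block ** B \<longleftrightarrow>
     (\<forall>i j. B $ Inr i $ Inr j = B $ Inl i $ Inl j \<and> B $ Inr i $ Inl j = - B $ Inl i $ Inr j)"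
  (is "_ \<longleftrightarrow> ?entries")
  for B :: "'n::finite rmat2"
proof
  assume "B ** std_block = std_block ** B"
  then have entry: "(B ** std_block) $ x $ y = (std_block ** B) $ x $ y" for x y by simp
  show ?entries
  proof (intro allI conjI)
    fix i j
    show "B $ Inr i $ Inr j = B $ Inl i $ Inl j"
      using entry[of "Inl i" "Inr j"] by (simp add: matrix_mult_std_block_nth std_block_matrix_mult_nth)
    show "B $ Inr i $ Inl j = - B $ Inl i $ Inr j"
      using entry[of "Inr i" "Inr j"] by (simp add: matrix_mult_std_block_nth std_block_matrix_mult_nth)
  qed
next
  assume ?entries
  show "B ** std_block = std_block ** B"
    unfolding vec_eq_iff
  proof (intro allI)
    fix x y :: "'n + 'n"
    show "(B ** std_block) $ x $ y = (std_block ** B) $ x $ y"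
      using \<open>?entries\<close>
      by (cases x; cases y) (simp_all add: matrix_mult_std_block_nth std_block_matrix_mult_nth)
  qed
qed

lemma commute_std_block_nth:
  fixes B :: "'n::finite rmat2"
  assumes "B ** std_block = std_block ** B"
  shows "B $ Inr i $ Inr j = B $ Inl i $ Inl j" and "B $ Inr i $ Inl j = - B $ Inl i $ Inr j"
  using assms unfolding commute_std_block_iff by simp_all

definition complex_form :: "'n::finite rmat2 \<Rightarrow> complex^'n^'n" where
  "complex_form B =
     (\<chi> i j. complex_of_real (B $ Inl i $ Inl j) + \<i> * complex_of_real (B $ Inl i $ Inr j))"

lemma complex_form_nth:
  "complex_form B $ i $ j = complex_of_real (B $ Inl i $ Inl j) + \<i> * complex_of_real (B $ Inl i $ Inr j)"
  by (simp add: complex_form_def)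

lemma complex_form_mult:
  fixes A B :: "'n::finite rmat2"
  assumes "B ** std_block = std_block ** B"
  shows "complex_form (A ** B) = complex_form A ** complex_form B"
  by (simp add: vec_eq_iff complex_form_nth matrix_matrix_mult_def sum_UNIV_Plus sum.distrib
      commute_std_block_nth[OF assms] algebra_simps of_real_sum sum_distrib_left sum_subtractf sum_negf)

lemma complex_form_mat1: "complex_form (mat 1) = mat 1"
  by (simp add: vec_eq_iff complex_form_nth mat_def)

lemma complex_form_add: "complex_form (A + B) = complex_form A + complex_form B"
  by (simp add: vec_eq_iff complex_form_nth algebra_simps)

lemma complex_form_scaleR: "complex_form (c *\<^sub>R A) = c *\<^sub>R complex_form A"
  by (simp add: vec_eq_iff complex_form_nth) (simp add: scaleR_conv_of_real algebra_simps)

lemma complex_form_transpose: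
  fixes B :: "'n::finite rmat2"
  assumes "B ** std_block = std_block ** B"
  shows "complex_form (transpose B) = (\<chi> i j. cnj (complex_form B $ j $ i))"
  by (simp add: vec_eq_iff complex_form_nth transpose_def commute_std_block_nth[OF assms])

lemma det_extend_by_identity:
  fixes e :: "'n::finite \<Rightarrow> 'm::finite" and A :: "'a::comm_ring_1^'m^'m" and X :: "'a^'n^'n"
  assumes "inj e"
    and embed: "\<And>i j. A $ e i $ e j = X $ i $ j"
    and outside: "\<And>i j. i \<notin> range e \<Longrightarrow> A $ i $ j = (if i = j then 1 else 0)"
  shows "det A = det X"
proof -
  let ?R = "range e"
  let ?term = "\<lambda>p. of_int (sign p) * (\<Prod>i\<in>UNIV. A $ i $ p i)"
  have map_perm: "map_permutation UNIV e q = (\<lambda>x. if x \<in> ?R then e (q (inv e x)) else x)" for q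
    by (simp add: fun_eq_iff map_permutation_def restrict_id_def)
  have bij: "bij_betw (map_permutation UNIV e) {q. q permutes UNIV} {p. p permutes ?R}"
    unfolding map_perm using bij_betw_permutations[of e UNIV ?R] \<open>inj e\<close>
    by (simp add: inj_on_imp_bij_betw)
  have "?term p = 0" if p: "p permutes UNIV" "\<not> p permutes ?R" for p
  proof -
    obtain i where "i \<notin> ?R" "p i \<noteq> i"
      using p unfolding permutes_def by blast
    then have "A $ i $ p i = 0" using outside by simp
    then have "(\<Prod>i\<in>UNIV. A $ i $ p i) = 0"
      by (intro prod_zero) auto
    then show ?thesis by simp
  qed
  then have "det A = sum ?term {p. p permutes ?R}"
    unfolding det_def by (intro sum.mono_neutral_right) (auto intro: permutes_subset)
  also have "\<dots> = sum (?term \<circ> map_permutation UNIV e) {q. q permutes UNIV}"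
    using sum.reindex_bij_betw[OF bij, of ?term] by (simp add: o_def)
  also have "\<dots> = det X"
    unfolding det_def
  proof (rule sum.cong[OF refl])
    fix q :: "'n \<Rightarrow> 'n" assume q: "q \<in> {q. q permutes UNIV}"
    have "(\<Prod>i\<in>UNIV. A $ i $ map_permutation UNIV e q i) = (\<Prod>i\<in>?R. A $ i $ map_permutation UNIV e q i)"
      by (rule prod.mono_neutral_right) (auto simp: map_perm outside)
    also have "\<dots> = (\<Prod>k\<in>UNIV. X $ k $ q k)"
      using \<open>inj e\<close> by (simp add: prod.reindex map_perm embed)
    finally show "(?term \<circ> map_permutation UNIV e) q = of_int (sign q) * (\<Prod>k\<in>UNIV. X $ k $ q k)"
      using sign_map_permutation[of e UNIV q] q \<open>inj e\<close> by simp
  qed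
  finally show ?thesis .
qed

lemma det_cmat: "det (cmat A) = complex_of_real (det A)"
  by (simp add: det_def cmat_def of_real_sum of_real_mult of_real_prod)

lemma det_cnj: "det (\<chi> i j. cnj (M $ i $ j)) = cnj (det M)"
  by (simp add: det_def)

lemma det_adjoint: "det (\<chi> i j. cnj (M $ j $ i)) = cnj (det M)"
proof -
  have "(\<chi> i j. cnj (M $ j $ i)) = (\<chi> i j. cnj (transpose M $ i $ j))"
    by (simp add: transpose_def)
  then show ?thesis by (simp add: det_cnj det_transpose)
qed

lemma det_complex_form:
  fixes B :: "'n::finite rmat2"
  assumes "B ** std_block = std_block ** B"
  shows "complex_of_real (det B) = cnj (det (complex_form B)) * det (complex_form B)"
proof -
  note entries = commute_std_block_nth[OF assms]
  define a where "a = complex_form B"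
  \<comment> \<open>\<open>U = ((1, \<i>), (1, -\<i>))\<close> conjugates \<open>cmat B\<close> into the block diagonal matrix \<open>diag (cnj a, a)\<close>\<close>
  define U :: "complex^('n+'n)^('n+'n)" where "U = (\<chi> x y. case (x, y) of
     (Inl p, Inl q) \<Rightarrow> (if p = q then 1 else 0) | (Inl p, Inr q) \<Rightarrow> (if p = q then \<i> else 0)
   | (Inr p, Inl q) \<Rightarrow> (if p = q then 1 else 0) | (Inr p, Inr q) \<Rightarrow> (if p = q then -\<i> else 0))"
  define V :: "complex^('n+'n)^('n+'n)" where "V = (\<chi> x y. case (x, y) of
     (Inl p, Inl q) \<Rightarrow> (if p = q then 1/2 else 0) | (Inl p, Inr q) \<Rightarrow> (if p = q then 1/2 else 0)
   | (Inr p, Inl q) \<Rightarrow> (if p = q then -\<i>/2 else 0) | (Inr p, Inr q) \<Rightarrow> (if p = q then \<i>/2 else 0))"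
  define D1 :: "complex^('n+'n)^('n+'n)" where "D1 = (\<chi> x y. case (x, y) of
     (Inl p, Inl q) \<Rightarrow> cnj (a $ p $ q) | (Inr p, Inr q) \<Rightarrow> (if p = q then 1 else 0) | _ \<Rightarrow> 0)"
  define D2 :: "complex^('n+'n)^('n+'n)" where "D2 = (\<chi> x y. case (x, y) of
     (Inl p, Inl q) \<Rightarrow> (if p = q then 1 else 0) | (Inr p, Inr q) \<Rightarrow> a $ p $ q | _ \<Rightarrow> 0)"
  have if_mult: "(if P then c else 0) * x = (if P then c * x else 0)"
    "x * (if P then c else 0) = (if P then x * c else 0)" for P and c x :: complex
    by simp_all
  have "U ** V = mat 1"
    unfolding vec_eq_iff
  proof (intro allI)
    fix x y show "(U ** V) $ x $ y = mat 1 $ x $ y"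
      by (cases x; cases y) (simp_all add: U_def V_def matrix_matrix_mult_def sum_UNIV_Plus mat_def if_mult)
  qed
  then have "det U \<noteq> 0"
    by (metis det_I det_mul mult_zero_left zero_neq_one)
  have "U ** cmat B = (D1 ** D2) ** U"
    unfolding vec_eq_iff
  proof (intro allI)
    fix x y show "(U ** cmat B) $ x $ y = ((D1 ** D2) ** U) $ x $ y"
      by (cases x; cases y) (simp_all add: U_def D1_def D2_def a_def complex_form_nth cmat_def entries
          matrix_matrix_mult_def sum_UNIV_Plus if_mult sum.distrib sum_subtractf algebra_simps)
  qed
  then have "det U * det (cmat B) = det D1 * det D2 * det U"
    by (metis det_mul)
  moreover have "det D1 = cnj (det a)"
    unfolding det_cnj[symmetric] by (rule det_extend_by_identity[of Inl]) (auto simp: D1_def split: sum.splits)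
  moreover have "det D2 = det a"
    by (rule det_extend_by_identity[of Inr]) (auto simp: D2_def split: sum.splits)
  ultimately show ?thesis
    using \<open>det U \<noteq> 0\<close> by (simp add: det_cmat a_def mult.commute)
qed

lemma det_eq_cmod_det_complex_form:
  fixes B :: "'n::finite rmat2"
  assumes "B ** std_block = std_block ** B"
  shows "det B = (cmod (det (complex_form B)))\<^sup>2"
  using det_complex_form[OF assms] complex_norm_square[of "det (complex_form B)"]
  by (metis mult.commute of_real_eq_iff)

lemma det_complex_form_real:
  fixes B G :: "'n::finite rmat2"
  assumes "B ** std_block = std_block ** B" and "G ** std_block = std_block ** G"
    and "det G \<noteq> 0" and "G ** B = transpose B ** G"
  shows "cnj (det (complex_form B)) = det (complex_form B)"
proof -
  have "complex_form G ** complex_form B = (\<chi> i j. cnj (complex_form B $ j $ i)) ** complex_form G"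
    using assms complex_form_mult complex_form_transpose by metis
  then have "det (complex_form G) * det (complex_form B) = cnj (det (complex_form B)) * det (complex_form G)"
    by (metis det_mul det_adjoint)
  moreover have "det (complex_form G) \<noteq> 0"
    using det_eq_cmod_det_complex_form[OF assms(2)] assms(3) by auto
  ultimately show ?thesis by simp
qed

section \<open>Bases adapted to a complex structure\<close>

lemma complex_structure_apply_twice:
  fixes J :: "real^'m^'m"
  assumes "J ** J = - mat 1"
  shows "J *v (J *v v) = - v"
  using assms by (simp add: matrix_vector_mul_assoc matrix_vector_mult_uminus_left)

lemma inj_complex_structure:
  fixes J :: "real^'m^'m"
  assumes "J ** J = - mat 1"
  shows "inj ((*v) J)"
  by (rule injI) (metis complex_structure_apply_twice[OF assms] minus_minus)

lemma complex_structure_span_stable: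
  fixes J :: "real^'m^'m"
  assumes JJ: "J ** J = - mat 1" and "y \<in> span (X \<union> (*v) J ` X)"
  shows "J *v y \<in> span (X \<union> (*v) J ` X)"
proof -
  let ?Y = "X \<union> (*v) J ` X"
  have "J *v z \<in> span ?Y" if z: "z \<in> ?Y" for z
  proof (cases "z \<in> X")
    case False
    then obtain x where "x \<in> X" "z = J *v x" using z by blast
    then have "J *v z = - x"
      using complex_structure_apply_twice[OF JJ] by simp
    then show ?thesis using \<open>x \<in> X\<close> by (simp add: span_neg span_base)
  qed (auto intro: span_base)
  then have "span ((*v) J ` ?Y) \<subseteq> span ?Y"
    by (intro span_minimal) auto
  then show ?thesis
    using assms(2) span_linear_image[OF matrix_vector_mul_linear, of J ?Y] by blast
qed

lemma complex_structure_not_in_span: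
  fixes J :: "real^'m^'m"
  assumes JJ: "J ** J = - mat 1" and v: "v \<notin> span (X \<union> (*v) J ` X)"
  shows "J *v v \<notin> span (X \<union> (*v) J ` X)" and "v \<notin> span (insert (J *v v) (X \<union> (*v) J ` X))"
proof -
  let ?Y = "X \<union> (*v) J ` X"
  have JJv: "J *v (J *v v) = - v"
    by (rule complex_structure_apply_twice[OF JJ])
  then show "J *v v \<notin> span ?Y"
    using complex_structure_span_stable[OF JJ, of "J *v v" X] v by (metis span_neg minus_minus)
  \<comment> \<open>if \<open>v - c J v\<close> lay in the \<open>J\<close>-stable span, so would \<open>(1 + c\<^sup>2) v\<close>\<close>
  show "v \<notin> span (insert (J *v v) ?Y)"
  proof
    assume "v \<in> span (insert (J *v v) ?Y)"
    then obtain c where c: "v - c *\<^sub>R (J *v v) \<in> span ?Y"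
      by (auto simp: span_breakdown_eq)
    have "J *v (v - c *\<^sub>R (J *v v)) = J *v v + c *\<^sub>R v"
      by (simp add: matrix_vector_mult_diff_distrib matrix_vector_mult_scaleR JJv)
    then have "J *v v + c *\<^sub>R v \<in> span ?Y"
      using complex_structure_span_stable[OF JJ c] by simp
    then have "(v - c *\<^sub>R (J *v v)) + c *\<^sub>R (J *v v + c *\<^sub>R v) \<in> span ?Y"
      by (intro span_add[OF c] span_scale)
    moreover have "(v - c *\<^sub>R (J *v v)) + c *\<^sub>R (J *v v + c *\<^sub>R v) = (1 + c\<^sup>2) *\<^sub>R v"
      by (simp add: algebra_simps power2_eq_square)
    ultimately have "(1 / (1 + c\<^sup>2)) *\<^sub>R ((1 + c\<^sup>2) *\<^sub>R v) \<in> span ?Y"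
      by (metis span_scale)
    moreover have "1 + c\<^sup>2 \<noteq> 0"
      by (metis add_nonneg_eq_0_iff zero_le_power2 zero_le_one zero_neq_one)
    ultimately show False using v by simp
  qed
qed

lemma complex_structure_extend_independent:
  fixes J :: "real^'m^'m"
  assumes JJ: "J ** J = - mat 1"
    and X: "finite X" "independent (X \<union> (*v) J ` X)" "X \<inter> (*v) J ` X = {}"
    and small: "2 * card X < CARD('m)"
  shows "\<exists>X'. finite X' \<and> independent (X' \<union> (*v) J ` X') \<and> X' \<inter> (*v) J ` X' = {}
           \<and> card X' = Suc (card X)"
proof -
  let ?Y = "X \<union> (*v) J ` X"
  have "card ?Y = 2 * card X"
    using X inj_complex_structure[OF JJ] by (simp add: card_Un_disjoint card_image inj_on_subset)
  then have "dim (span ?Y) < dim (UNIV :: (real^'m) set)"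
    using small dim_span_eq_card_independent[OF X(2)] by simp
  then obtain v where v: "v \<notin> span ?Y"
    by (metis UNIV_eq_I less_irrefl)
  note v_new = complex_structure_not_in_span[OF JJ v]
  have Y': "insert v X \<union> (*v) J ` insert v X = insert v (insert (J *v v) ?Y)"
    by auto
  have "v \<notin> ?Y" "J *v v \<notin> ?Y" "v \<noteq> J *v v"
    using v v_new by (auto intro: span_base)
  show ?thesis
  proof (intro exI[of _ "insert v X"] conjI)
    show "finite (insert v X)"
      using X(1) by simp
    show "independent (insert v X \<union> (*v) J ` insert v X)"
      unfolding Y' by (intro independent_insertI v_new X(2))
    show "insert v X \<inter> (*v) J ` insert v X = {}"
      using X(3) \<open>v \<notin> ?Y\<close> \<open>J *v v \<notin> ?Y\<close> \<open>v \<noteq> J *v v\<close> by auto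
    show "card (insert v X) = Suc (card X)"
      using X(1) \<open>v \<notin> ?Y\<close> by simp
  qed
qed

lemma complex_structure_independent_set:
  fixes J :: "real^'m^'m"
  assumes "J ** J = - mat 1" and "2 * k \<le> CARD('m)"
  shows "\<exists>X. finite X \<and> independent (X \<union> (*v) J ` X) \<and> X \<inter> (*v) J ` X = {} \<and> card X = k"
  using assms(2)
proof (induction k)
  case 0
  show ?case by (intro exI[of _ "{}"]) (simp add: independent_empty)
next
  case (Suc k)
  then obtain X where "finite X" "independent (X \<union> (*v) J ` X)" "X \<inter> (*v) J ` X = {}" "card X = k"
    by auto
  with complex_structure_extend_independent[OF assms(1)] Suc.prems show ?case
    by auto
qed

lemma invertible_if_independent_columns:
  fixes g :: "'m::finite \<Rightarrow> real^'m"
  assumes "inj g" and "independent (range g)"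
  shows "invertible (\<chi> r c. g c $ r)"
proof -
  have "x = 0" if "(\<chi> r c. g c $ r) *v x = 0" for x
  proof -
    have "(\<Sum>c\<in>UNIV. x $ c *\<^sub>R g c) = 0"
      using that by (simp add: vec_eq_iff matrix_vector_mult_def sum_component mult.commute)
    then have "(\<Sum>y\<in>range g. x $ inv g y *\<^sub>R y) = 0"
      using \<open>inj g\<close> by (simp add: sum.reindex)
    moreover have "\<forall>c. (\<Sum>y\<in>range g. c y *\<^sub>R y) = 0 \<longrightarrow> (\<forall>y\<in>range g. c y = 0)"
      using assms(2) unfolding eucl.independent_explicit by blast
    ultimately have "\<forall>y\<in>range g. x $ inv g y = 0"
      by (rule spec[of _ "\<lambda>y. x $ inv g y", THEN mp, rotated])
    then show "x = 0"
      using \<open>inj g\<close> by (simp add: vec_eq_iff)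
  qed
  then show ?thesis
    by (metis invertible_left_inverse matrix_left_invertible_ker)
qed

lemma complex_structure_frame:
  fixes J :: "'n::finite rmat2"
  assumes JJ: "J ** J = - mat 1"
  obtains f :: "'n \<Rightarrow> real^('n+'n)"
  where "inj (\<lambda>c. case c of Inl j \<Rightarrow> J *v f j | Inr j \<Rightarrow> f j)"
    and "independent (range (\<lambda>c. case c of Inl j \<Rightarrow> J *v f j | Inr j \<Rightarrow> f j))"
proof -
  obtain X where X: "independent (X \<union> (*v) J ` X)" "X \<inter> (*v) J ` X = {}"
    and "finite X" "card X = CARD('n)"
    using complex_structure_independent_set[OF JJ, of "CARD('n)"] by (auto simp: card_Plus)
  then obtain f where f: "bij_betw f (UNIV::'n set) X"
    using finite_same_card_bij[of "UNIV::'n set" X] by auto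
  let ?g = "\<lambda>c. case c of Inl j \<Rightarrow> J *v f j | Inr j \<Rightarrow> f j"
  have "range ?g = ?g ` range Inl \<union> ?g ` range Inr"
    by (metis UNIV_sum image_Un)
  also have "\<dots> = (*v) J ` range f \<union> range f"
    by (simp add: image_image)
  finally have indep: "independent (range ?g)"
    using X(1) f by (simp add: bij_betw_def Un_commute)
  have "inj ?g"
  proof (rule injI)
    have "f i = f j \<Longrightarrow> i = j" and "f i \<noteq> J *v f j" for i j
      using f X(2) by (auto simp: bij_betw_def inj_on_def)
    moreover fix a b assume "?g a = ?g b"
    ultimately show "a = b"
      using injD[OF inj_complex_structure[OF JJ]] by (cases a; cases b) (simp_all, metis)
  qed
  from that[OF this indep] show ?thesis .
qed

lemma complex_structure_similar_std_block:
  fixes J :: "'n::finite rmat2"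
  assumes JJ: "J ** J = - mat 1"
  shows "\<exists>S. invertible S \<and> S ** J ** matrix_inv S = (std_block :: 'n rmat2)"
proof -
  obtain f :: "'n \<Rightarrow> real^('n+'n)" where inj: "inj (\<lambda>c. case c of Inl j \<Rightarrow> J *v f j | Inr j \<Rightarrow> f j)"
    and indep: "independent (range (\<lambda>c. case c of Inl j \<Rightarrow> J *v f j | Inr j \<Rightarrow> f j))"
    by (rule complex_structure_frame[OF JJ])
  define P :: "'n rmat2" where "P = (\<chi> r c. (case c of Inl j \<Rightarrow> J *v f j | Inr j \<Rightarrow> f j) $ r)"
  have "invertible P"
    unfolding P_def using inj indep by (rule invertible_if_independent_columns)
  have "J ** P = P ** std_block"
    unfolding vec_eq_iff
  proof (intro allI)
    fix r c
    have "(J ** P) $ r $ c = (J *v (case c of Inl j \<Rightarrow> J *v f j | Inr j \<Rightarrow> f j)) $ r"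
      by (simp add: matrix_matrix_mult_def matrix_vector_mult_def P_def)
    then show "(J ** P) $ r $ c = (P ** std_block) $ r $ c"
      by (cases c) (simp_all add: matrix_mult_std_block_nth P_def complex_structure_apply_twice[OF JJ])
  qed
  define S where "S = matrix_inv P"
  have "invertible S" and "matrix_inv S = P"
    using matrix_inv_left[OF \<open>invertible P\<close>] matrix_inv_right[OF \<open>invertible P\<close>]
    by (auto simp: S_def invertible_def intro: matrix_inv_unique)
  moreover have "S ** J ** P = std_block"
    using \<open>J ** P = P ** std_block\<close> matrix_inv_left[OF \<open>invertible P\<close>]
    by (simp add: S_def flip: matrix_mul_assoc) (simp add: matrix_mul_assoc)
  ultimately have "invertible S \<and> S ** J ** matrix_inv S = std_block"
    by simp
  then show ?thesis ..
qed

section \<open>Positivity of the complex determinant\<close>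

lemma commute_std_block_if_congruence:
  fixes G :: "'n::finite rmat2"
  assumes "transpose std_block ** G ** std_block = G"
  shows "G ** std_block = std_block ** G"
proof -
  have "G ** std_block = - (std_block ** G ** std_block) ** std_block"
    using assms by (simp add: transpose_std_block matrix_mult_uminus_left)
  also have "\<dots> = - (std_block ** G ** (std_block ** std_block))"
    by (simp add: matrix_mult_uminus_left matrix_mul_assoc)
  also have "\<dots> = std_block ** G"
    by (simp add: std_block_squared matrix_mult_uminus_right)
  finally show ?thesis .
qed

lemma continuous_on_det_segment:
  fixes c :: "complex^'n^'n"
  shows "continuous_on S (\<lambda>t::real. det ((1 - t) *\<^sub>R mat 1 + t *\<^sub>R c))"
  unfolding det_def by (intro continuous_intros)

lemma det_complex_form_pos:
  fixes B G :: "'n::finite rmat2"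
  assumes B: "B ** std_block = std_block ** B" and G: "G ** std_block = std_block ** G"
    and "pos_def G" and "pos_def (G ** B)" and GB: "G ** B = transpose B ** G"
  shows "\<exists>r>0. det (complex_form B) = complex_of_real r"
proof -
  define B' where "B' t = (1 - t) *\<^sub>R mat 1 + t *\<^sub>R B" for t :: real
  define f where "f t = Re (det (complex_form (B' t)))" for t
  have "det G \<noteq> 0"
    using \<open>pos_def G\<close> by (rule pos_def_det_nonzero)
  have commute: "B' t ** std_block = std_block ** B' t" for t
    using B by (simp add: B'_def matrix_add_rdistrib matrix_add_ldistrib matrix_scalar_ac scalar_matrix_assoc[symmetric])
  have adjoint: "G ** B' t = transpose (B' t) ** G" for t
    using GB by (simp add: B'_def matrix_add_rdistrib matrix_add_ldistrib transpose_add transpose_scalar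
        matrix_scalar_ac scalar_matrix_assoc[symmetric])
  have real: "det (complex_form (B' t)) = complex_of_real (f t)" for t
    using det_complex_form_real[OF commute G \<open>det G \<noteq> 0\<close> adjoint] by (simp add: f_def complex_eq_iff)
  \<comment> \<open>on the segment from \<open>1\<close> to \<open>B\<close> the determinant never vanishes, as \<open>G B' t\<close> stays positive definite\<close>
  have nonzero: "f t \<noteq> 0" if "0 \<le> t" "t \<le> 1" for t
  proof -
    have "v \<bullet> ((G ** B' t) *v v) = (1 - t) * (v \<bullet> (G *v v)) + t * (v \<bullet> ((G ** B) *v v))" for v
      by (simp add: B'_def matrix_add_ldistrib matrix_scalar_ac matrix_vector_mult_add_rdistrib
          scalar_matrix_assoc[symmetric] scaleR_matrix_vector_assoc[symmetric] inner_add_right)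
    then have "pos_def (G ** B' t)"
      using \<open>pos_def G\<close> \<open>pos_def (G ** B)\<close> that unfolding pos_def_def
      by (smt (verit) mult_nonneg_nonneg mult_pos_pos)
    then have "det (B' t) \<noteq> 0"
      using pos_def_det_nonzero by (fastforce simp: det_mul)
    then show ?thesis
      using det_eq_cmod_det_complex_form[OF commute, of t] real[of t] by auto
  qed
  have "continuous_on {0..1} f"
    unfolding f_def B'_def complex_form_add complex_form_scaleR complex_form_mat1
    by (intro continuous_on_Re continuous_on_det_segment)
  moreover have "f 0 = 1"
    using real[of 0] by (simp add: B'_def complex_form_mat1)
  ultimately have "f 1 > 0"
    using IVT2'[of f 1 0 0] nonzero by force
  then show ?thesis
    using real[of 1] by (auto simp: B'_def)
qed

lemma detbar_pos:
  fixes J G C :: "'n::finite rmat2"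
  assumes JJ: "J ** J = - mat 1" and "pos_def G" and JGJ: "transpose J ** G ** J = G"
    and CJ: "C ** J = J ** C" and GC: "G ** C = transpose C ** G" and "pos_def (G ** C)"
  shows "\<exists>r>0. detbar J C = complex_of_real r \<and> det C = r\<^sup>2"
proof -
  define S where "S = (SOME S. invertible S \<and> S ** J ** matrix_inv S = (std_block :: 'n rmat2))"
  have "invertible S" and SJT: "S ** J ** matrix_inv S = std_block"
    unfolding S_def using someI_ex[OF complex_structure_similar_std_block[OF JJ]] by auto
  define T where "T = matrix_inv S"
  have TS: "T ** S = mat 1" and ST: "S ** T = mat 1"
    using \<open>invertible S\<close> by (simp_all add: T_def matrix_inv_left matrix_inv_right)
  have "transpose S ** transpose T = mat 1"
    using TS by (metis matrix_transpose_mul transpose_mat)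
  then have cancel: "T ** (S ** X) = X" "transpose S ** (transpose T ** X) = X" for X :: "'n rmat2"
    using TS by (metis matrix_mul_assoc matrix_mul_lid)+
  \<comment> \<open>\<open>X \<mapsto> S X T\<close> is a similarity and \<open>G \<mapsto> T\<^sup>T G T\<close> the matching congruence\<close>
  have sim_mult: "S ** X ** T ** (S ** Y ** T) = S ** (X ** Y) ** T"
    and cong_sim: "transpose T ** H ** T ** (S ** X ** T) = transpose T ** (H ** X) ** T"
    and sim_cong: "transpose (S ** X ** T) ** (transpose T ** H ** T) = transpose T ** (transpose X ** H) ** T"
    for X Y H :: "'n rmat2"
    by (simp_all add: matrix_transpose_mul cancel flip: matrix_mul_assoc)
  let ?B = "S ** C ** T" and ?G = "transpose T ** G ** T"
  have "?B ** std_block = std_block ** ?B"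
    using CJ by (simp flip: SJT T_def add: sim_mult)
  moreover have "?G ** std_block = std_block ** ?G"
    by (rule commute_std_block_if_congruence)
      (simp flip: SJT T_def add: sim_cong cong_sim JGJ)
  moreover have "pos_def ?G" and "pos_def (?G ** ?B)"
    using pos_def_congruence[OF _ ST] \<open>pos_def G\<close> \<open>pos_def (G ** C)\<close> by (simp_all add: cong_sim)
  moreover have "?G ** ?B = transpose ?B ** ?G"
    by (simp add: cong_sim sim_cong GC)
  ultimately obtain r where "r > 0" and r: "det (complex_form ?B) = complex_of_real r"
    using det_complex_form_pos by blast
  have "detbar J C = det (complex_form ?B)"
    by (simp add: detbar_def Let_def complex_form_def T_def flip: S_def)
  moreover have "det C = det ?B"
    using TS by (simp add: det_mul) (metis det_I det_mul mult.commute mult.left_commute mult_1_right)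
  ultimately show ?thesis
    using \<open>r > 0\<close> r det_eq_cmod_det_complex_form[OF \<open>?B ** std_block = std_block ** ?B\<close>] by auto
qed

section \<open>Positivity of the hyperbolic cosine of a skew-symmetric matrix\<close>

lemma linear_le_quadratic_imp_zero:
  fixes a d :: real
  assumes "\<And>s. 2 * s * a \<le> s\<^sup>2 * d"
  shows "a = 0"
proof -
  define e where "e = \<bar>d\<bar> + 1"
  have "e > 0" by (simp add: e_def add_nonneg_pos)
  have "2 * (a / e) * a \<le> (a / e)\<^sup>2 * d" by (rule assms)
  then have "2 * a\<^sup>2 * e \<le> a\<^sup>2 * d"
    using \<open>e > 0\<close> by (simp add: power2_eq_square field_simps)
  also have "\<dots> \<le> a\<^sup>2 * (e - 1)"
    by (intro mult_left_mono) (auto simp: e_def)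
  finally have "a\<^sup>2 * (e + 1) \<le> 0"
    by (simp add: algebra_simps)
  with \<open>e > 0\<close> show ?thesis
    by (smt (verit) mult_pos_pos zero_less_power2)
qed

lemma eigenvector_if_maximises_quadratic_form:
  fixes M :: "real^'m^'m"
  assumes sym: "transpose M = M" and W: "subspace W" and invariant: "\<And>x. x \<in> W \<Longrightarrow> M *v x \<in> W"
    and "w \<in> W" and "w \<bullet> w = 1"
    and bound: "\<And>x. x \<in> W \<Longrightarrow> x \<bullet> (M *v x) \<le> (w \<bullet> (M *v w)) * (x \<bullet> x)"
  shows "M *v w = (w \<bullet> (M *v w)) *\<^sub>R w"
proof -
  let ?q = "\<lambda>x. x \<bullet> (M *v x)"
  have M_sym: "x \<bullet> (M *v y) = y \<bullet> (M *v x)" for x y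
    using inner_transpose_matrix_vector[of x M y] sym by (simp add: inner_commute)
  \<comment> \<open>stationarity of the Rayleigh quotient at its maximiser \<open>w\<close>, in each direction of \<open>W\<close> orthogonal to \<open>w\<close>\<close>
  have orth: "u \<bullet> (M *v w) = 0" if u: "u \<in> W" "u \<bullet> w = 0" for u
  proof (rule linear_le_quadratic_imp_zero)
    fix s :: real
    have "w + s *\<^sub>R u \<in> W" using u \<open>w \<in> W\<close> W by (simp add: subspace_add subspace_scale)
    moreover have "?q (w + s *\<^sub>R u) = ?q w + 2 * s * (u \<bullet> (M *v w)) + s\<^sup>2 * ?q u"
      using M_sym[of w u] by (simp add: matrix_vector_right_distrib matrix_vector_mult_scaleR
          inner_add_left inner_add_right power2_eq_square algebra_simps)
    moreover have "(w + s *\<^sub>R u) \<bullet> (w + s *\<^sub>R u) = 1 + s\<^sup>2 * (u \<bullet> u)"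
      using u(2) \<open>w \<bullet> w = 1\<close>
      by (simp add: inner_add_left inner_add_right inner_commute power2_eq_square algebra_simps)
    ultimately show "2 * s * (u \<bullet> (M *v w)) \<le> s\<^sup>2 * (?q w * (u \<bullet> u) - ?q u)"
      using bound[of "w + s *\<^sub>R u"] by (simp add: algebra_simps)
  qed
  define u where "u = M *v w - ?q w *\<^sub>R w"
  have "u \<in> W"
    using invariant[OF \<open>w \<in> W\<close>] \<open>w \<in> W\<close> W by (simp add: u_def subspace_diff subspace_scale)
  moreover have "u \<bullet> w = 0"
    using \<open>w \<bullet> w = 1\<close> by (simp add: u_def inner_diff_left inner_diff_right inner_commute)
  ultimately have "u \<bullet> u = 0"
    using orth by (simp add: u_def inner_diff_right)
  then show ?thesis by (simp add: u_def)
qed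

lemma symmetric_eigenvector_in_invariant_subspace:
  fixes M :: "real^'m^'m"
  assumes sym: "transpose M = M"
    and W: "subspace W" "W \<noteq> {0}" and invariant: "\<And>x. x \<in> W \<Longrightarrow> M *v x \<in> W"
  shows "\<exists>w\<in>W. norm w = 1 \<and> M *v w = (w \<bullet> (M *v w)) *\<^sub>R w"
proof -
  let ?q = "\<lambda>x. x \<bullet> (M *v x)" and ?S = "sphere 0 1 \<inter> W"
  obtain x0 where "x0 \<in> W" "x0 \<noteq> 0" using W subspace_0 by blast
  then have "(1 / norm x0) *\<^sub>R x0 \<in> ?S" using W(1) by (simp add: subspace_scale)
  moreover have "compact ?S"
    by (rule compact_Int_closed[OF compact_sphere closed_subspace[OF W(1)]])
  moreover have "continuous_on ?S ?q"
    by (intro continuous_intros matrix_vector_mult_linear_continuous_on)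
  \<comment> \<open>a maximiser of the Rayleigh quotient on the unit sphere of \<open>W\<close>\<close>
  ultimately obtain w where w: "w \<in> ?S" and max: "\<And>y. y \<in> ?S \<Longrightarrow> ?q y \<le> ?q w"
    using continuous_attains_sup[of ?S ?q] by blast
  have "w \<in> W" and "w \<bullet> w = 1" using w by (auto simp: dot_square_norm)
  have "?q x \<le> ?q w * (x \<bullet> x)" if "x \<in> W" for x
  proof (cases "x = 0")
    case False
    have "(1 / norm x) *\<^sub>R x \<in> ?S" using that False W(1) by (simp add: subspace_scale)
    then have "?q ((1 / norm x) *\<^sub>R x) \<le> ?q w"
      by (rule max)
    moreover have "?q ((1 / norm x) *\<^sub>R x) = ?q x / (x \<bullet> x)"
      by (simp add: matrix_vector_mult_scaleR dot_square_norm power2_eq_square)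
    ultimately have "?q x / (x \<bullet> x) \<le> ?q w" by simp
    then show ?thesis using False by (simp add: divide_le_eq mult.commute)
  qed simp
  with eigenvector_if_maximises_quadratic_form[OF sym W(1) invariant \<open>w \<in> W\<close> \<open>w \<bullet> w = 1\<close>]
  show ?thesis using w by auto
qed

lemma quadratic_form_pos_add_eigenvector:
  fixes C :: "real^'m^'m"
  assumes "transpose C = C" and Cw: "C *v w = l *\<^sub>R w" and "l > 0" and "w \<noteq> 0" and "u \<bullet> w = 0"
    and u_pos: "u \<noteq> 0 \<Longrightarrow> 0 < u \<bullet> (C *v u)" and "u + a *\<^sub>R w \<noteq> 0"
  shows "0 < (u + a *\<^sub>R w) \<bullet> (C *v (u + a *\<^sub>R w))"
proof -
  have "w \<bullet> (C *v u) = u \<bullet> (C *v w)"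
    using inner_transpose_matrix_vector[of w C u] assms(1) by (simp add: inner_commute)
  then have "w \<bullet> (C *v u) = 0"
    using Cw \<open>u \<bullet> w = 0\<close> by simp
  then have "(u + a *\<^sub>R w) \<bullet> (C *v (u + a *\<^sub>R w)) = u \<bullet> (C *v u) + a\<^sup>2 * l * (w \<bullet> w)"
    using Cw \<open>u \<bullet> w = 0\<close> by (simp add: matrix_vector_right_distrib matrix_vector_mult_scaleR
        inner_add_left inner_add_right inner_commute power2_eq_square algebra_simps)
  moreover have "0 \<le> a\<^sup>2 * l * (w \<bullet> w)" and "a \<noteq> 0 \<Longrightarrow> 0 < a\<^sup>2 * l * (w \<bullet> w)"
    using \<open>l > 0\<close> \<open>w \<noteq> 0\<close> by simp_all
  ultimately show ?thesis
    using u_pos \<open>u + a *\<^sub>R w \<noteq> 0\<close> by (cases "u = 0") (auto simp: add_pos_nonneg)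
qed

lemma orthogonal_complement_invariant:
  fixes M :: "real^'m^'m"
  assumes "transpose M = M" and W: "subspace W" and invariant: "\<forall>x\<in>W. M *v x \<in> W"
    and "w \<in> W" and "w \<noteq> 0" and Mw: "M *v w = \<mu> *\<^sub>R w"
  defines "W' \<equiv> {x \<in> W. x \<bullet> w = 0}"
  shows "subspace W'" and "\<forall>x\<in>W'. M *v x \<in> W'" and "dim W' < dim W"
proof -
  show "subspace W'"
    using W unfolding W'_def subspace_def by (auto simp: inner_add_left)
  show "\<forall>x\<in>W'. M *v x \<in> W'"
  proof
    fix x assume "x \<in> W'"
    have "(M *v x) \<bullet> w = x \<bullet> (M *v w)"
      using inner_transpose_matrix_vector[of x M w] assms(1) by (simp add: inner_commute)
    then show "M *v x \<in> W'"
      using \<open>x \<in> W'\<close> invariant by (simp add: W'_def Mw)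
  qed
  have "w \<notin> W'"
    using \<open>w \<noteq> 0\<close> by (simp add: W'_def)
  then have "W' \<subset> W"
    using \<open>w \<in> W\<close> unfolding W'_def by blast
  then have "span W' \<subset> span W"
    using \<open>subspace W'\<close> W by (metis span_eq_iff)
  then show "dim W' < dim W"
    by (metis eucl.dim_psubset)
qed

lemma pos_def_if_eigenvectors_positive:
  fixes M C :: "real^'m^'m"
  assumes M: "transpose M = M" and C: "transpose C = C"
    and eig: "\<And>w \<mu>. w \<noteq> 0 \<Longrightarrow> M *v w = \<mu> *\<^sub>R w \<Longrightarrow> \<exists>l>0. C *v w = l *\<^sub>R w"
  shows "pos_def C"
proof -
  \<comment> \<open>induction on the dimension of an \<open>M\<close>-invariant subspace, splitting off one eigenvector of \<open>M\<close>\<close>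
  have "\<forall>v\<in>W. v \<noteq> 0 \<longrightarrow> 0 < v \<bullet> (C *v v)" if "subspace W" "\<forall>x\<in>W. M *v x \<in> W" "dim W = n" for W n
    using that
  proof (induction n arbitrary: W rule: less_induct)
    case (less n W)
    show ?case
    proof (intro ballI impI)
      fix v assume "v \<in> W" "v \<noteq> 0"
      then obtain w where "w \<in> W" "norm w = 1" and Mw: "M *v w = (w \<bullet> (M *v w)) *\<^sub>R w"
        using symmetric_eigenvector_in_invariant_subspace[OF M less.prems(1)] less.prems(2) by blast
      moreover have "w \<noteq> 0" using \<open>norm w = 1\<close> by auto
      ultimately obtain l where "l > 0" and Cw: "C *v w = l *\<^sub>R w"
        using eig by blast
      note W' = orthogonal_complement_invariant[OF M less.prems(1,2) \<open>w \<in> W\<close> \<open>w \<noteq> 0\<close> Mw]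
      have IH: "\<forall>x\<in>{x \<in> W. x \<bullet> w = 0}. x \<noteq> 0 \<longrightarrow> 0 < x \<bullet> (C *v x)"
        using less.IH[OF _ W'(1,2) refl] W'(3) less.prems(3) by blast
      define a where "a = v \<bullet> w"
      define u where "u = v - a *\<^sub>R w"
      have "w \<bullet> w = 1" using \<open>norm w = 1\<close> by (simp add: dot_square_norm)
      then have "u \<in> W" and "u \<bullet> w = 0"
        using \<open>v \<in> W\<close> \<open>w \<in> W\<close> less.prems(1)
        by (simp_all add: u_def a_def subspace_diff subspace_scale inner_diff_left)
      have "0 < (u + a *\<^sub>R w) \<bullet> (C *v (u + a *\<^sub>R w))"
        using IH \<open>u \<in> W\<close> \<open>v \<noteq> 0\<close>
        by (intro quadratic_form_pos_add_eigenvector[OF C Cw \<open>l > 0\<close> \<open>w \<noteq> 0\<close> \<open>u \<bullet> w = 0\<close>])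
          (auto simp: \<open>u \<bullet> w = 0\<close>, simp add: u_def)
      then show "0 < v \<bullet> (C *v v)"
        by (simp add: u_def)
    qed
  qed
  from this[OF subspace_UNIV _ refl] show ?thesis
    by (simp add: pos_def_def)
qed

definition cvec :: "real^'m \<Rightarrow> complex^'m" where
  "cvec x = (\<chi> i. complex_of_real (x $ i))"

lemma cmat_mult_cvec: "cmat A *v cvec x = cvec (A *v x)"
  by (simp add: vec_eq_iff cmat_def cvec_def matrix_vector_mult_def)

lemma cvec_eq_0_iff: "cvec x = 0 \<longleftrightarrow> x = 0"
  by (simp add: vec_eq_iff cvec_def)

lemma eigenvalue_of_square:
  fixes K :: "real^'m^'m"
  assumes KK: "(K ** K) *v w = a *\<^sub>R w" and "w \<noteq> 0" and c: "c * c = complex_of_real a"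
  shows "c \<in> eigenvalues K \<or> - c \<in> eigenvalues K"
proof -
  let ?A = "cmat K" and ?w = "cvec w"
  let ?u = "?A *v ?w"
  have "?w \<noteq> 0" using \<open>w \<noteq> 0\<close> by (simp add: cvec_eq_0_iff)
  have "?A *v ?u = cvec ((K ** K) *v w)"
    by (simp only: cmat_mult_cvec matrix_vector_mul_assoc)
  then have Au: "?A *v ?u = (c * c) *s ?w"
    using KK by (simp add: c vec_eq_iff cvec_def)
  have mat_mult: "mat z *v x = z *s x" for z and x :: "complex^'m"
    by (simp add: vec_eq_iff matrix_vector_mult_def mat_def if_distrib[of "\<lambda>y. y * b" for b] cong: if_cong)
  \<comment> \<open>\<open>K u = c\<^sup>2 w\<close> with \<open>u = K w\<close>: either \<open>u + c w\<close> is a \<open>c\<close>-eigenvector or \<open>w\<close> is a \<open>-c\<close>-eigenvector\<close>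
  show ?thesis
  proof (cases "?u + c *s ?w = 0")
    case False
    have "(mat c - ?A) *v (?u + c *s ?w) = c *s ?u + (c * c) *s ?w - (?A *v ?u + c *s ?u)"
      by (simp add: mat_mult matrix_vector_mult_diff_rdistrib matrix_vector_right_distrib
          vector_scalar_commute vec_eq_iff algebra_simps)
    also have "\<dots> = 0" by (simp add: Au)
    finally show ?thesis
      using False by (auto simp: eigenvalues_def det_eq_0_iff_kernel)
  next
    case True
    then have "(mat (- c) - ?A) *v ?w = 0"
      by (simp add: mat_mult matrix_vector_mult_diff_rdistrib vec_eq_iff add_eq_0_iff)
    then show ?thesis
      using \<open>?w \<noteq> 0\<close> by (auto simp: eigenvalues_def det_eq_0_iff_kernel)
  qed
qed

lemma pos_def_mcosh_skew:
  fixes K :: "real^'m^'m"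
  assumes skew: "transpose K = - K" and small: "\<forall>c\<in>eigenvalues K. cmod c < pi / 2"
  shows "pos_def (mcosh K)"
proof (rule pos_def_if_eigenvectors_positive)
  show "transpose (transpose K ** K) = transpose K ** K"
    by (simp add: matrix_transpose_mul)
  show "transpose (mcosh K) = mcosh K"
    by (simp add: mcosh_transpose skew mcosh_uminus)
  fix w \<mu> assume "w \<noteq> 0" and w: "(transpose K ** K) *v w = \<mu> *\<^sub>R w"
  have "\<mu> * (w \<bullet> w) = (K *v w) \<bullet> (K *v w)"
    using w by (metis inner_scaleR_left inner_transpose_matrix_vector matrix_vector_mul_assoc inner_commute)
  then have "\<mu> \<ge> 0"
    using \<open>w \<noteq> 0\<close> by (metis inner_ge_zero inner_gt_zero_iff zero_le_mult_iff not_less)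
  define s where "s = sqrt \<mu>"
  have "- ((K ** K) *v w) = (s\<^sup>2) *\<^sub>R w"
    using w \<open>\<mu> \<ge> 0\<close> by (simp add: s_def skew matrix_mult_uminus_left matrix_vector_mult_uminus_left)
  then have KK: "(K ** K) *v w = (- (s\<^sup>2)) *\<^sub>R w"
    by (metis minus_minus scaleR_minus_left)
  have "(\<i> * complex_of_real s) * (\<i> * complex_of_real s) = complex_of_real (- (s\<^sup>2))"
    by (simp add: power2_eq_square mult_ac)
  from eigenvalue_of_square[OF KK \<open>w \<noteq> 0\<close> this] have "s < pi / 2"
    using small \<open>\<mu> \<ge> 0\<close> by (auto simp: s_def norm_mult)
  moreover have "s \<ge> 0"
    using \<open>\<mu> \<ge> 0\<close> by (simp add: s_def)
  ultimately have "cos s > 0"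
    using pi_gt_zero by (intro cos_gt_zero_pi) linarith+
  then show "\<exists>l>0. mcosh K *v w = l *\<^sub>R w"
    using mcosh_eigenvector[OF KK] by blast
qed

section \<open>The bosonic and fermionic cases\<close>

lemma sp_alg_transpose:
  assumes "K \<in> sp_alg"
  shows "transpose K = Omega ** K ** Omega"
proof -
  have "Omega ** K ** Omega = - (Omega ** Omega ** transpose K)"
    using assms by (simp add: sp_alg_def matrix_mult_uminus_right flip: matrix_mul_assoc)
  then show ?thesis
    by (simp add: std_block_squared matrix_mult_uminus_left)
qed

lemma bosonic_cs_transpose:
  assumes "bosonic_cs J"
  shows "transpose J = Omega ** J ** Omega"
proof -
  have JJ: "J ** J = - mat 1" and "J ** Omega ** transpose J = Omega"
    using assms by (auto simp: bosonic_cs_def)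
  then have "J ** (J ** Omega ** transpose J) = J ** Omega"
    by simp
  then have "Omega ** transpose J = - (J ** Omega)"
    by (simp add: matrix_mul_assoc JJ matrix_mult_uminus_left minus_equation_iff)
  then have "Omega ** (Omega ** transpose J) = - (Omega ** J ** Omega)"
    by (simp add: matrix_mult_uminus_right matrix_mul_assoc)
  then show ?thesis
    by (simp add: matrix_mul_assoc std_block_squared matrix_mult_uminus_left)
qed

lemma bosonic_metric:
  fixes J K :: "'n::finite rmat2"
  assumes J: "bosonic_cs J" and K: "K \<in> u_perp sp_alg J"
  defines "H \<equiv> - (Omega ** J)"
  shows "pos_def H" and "transpose J ** H ** J = H" and "H ** K = transpose K ** H"
proof -
  have JJ: "J ** J = - mat 1" and pos: "pos_def (- (J ** Omega))"
    using J by (auto simp: bosonic_cs_def pos_def_def)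
  have "- (J ** Omega) ** H = J ** (Omega ** Omega) ** J"
    by (simp add: H_def matrix_mult_uminus_left matrix_mult_uminus_right matrix_mul_assoc)
  also have "\<dots> = mat 1"
    by (simp add: std_block_squared matrix_mult_uminus_left matrix_mult_uminus_right JJ)
  finally show "pos_def H"
    by (rule pos_def_right_inverse[OF pos])
  have "transpose J ** H ** J = - (transpose J ** Omega ** (J ** J))"
    by (simp add: H_def matrix_mult_uminus_left matrix_mult_uminus_right matrix_mul_assoc)
  also have "\<dots> = transpose J ** Omega"
    by (simp add: JJ matrix_mult_uminus_right)
  also have "\<dots> = H"
    by (simp add: bosonic_cs_transpose[OF J] H_def std_block_squared matrix_mult_uminus_right
        flip: matrix_mul_assoc)
  finally show "transpose J ** H ** J = H" .
  have "J ** K = - (K ** J)" and "K \<in> sp_alg"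
    using K by (auto simp: u_perp_def minus_equation_iff)
  then have "H ** K = Omega ** K ** J"
    by (simp add: H_def matrix_mult_uminus_left matrix_mult_uminus_right flip: matrix_mul_assoc)
  also have "\<dots> = - (Omega ** K ** (Omega ** Omega) ** J)"
    by (simp add: std_block_squared matrix_mult_uminus_left matrix_mult_uminus_right)
  also have "\<dots> = transpose K ** H"
    by (simp add: sp_alg_transpose[OF \<open>K \<in> sp_alg\<close>] H_def matrix_mult_uminus_right
        matrix_mul_assoc)
  finally show "H ** K = transpose K ** H" .
qed

lemma mcosh_positive_for_invariant_metric:
  fixes J K :: "'n::finite rmat2"
  assumes "(bosonic_cs J \<and> K \<in> u_perp sp_alg J) \<or> (fermionic_cs J \<and> K \<in> I_u_perp so_alg J)"
  shows "\<exists>G. pos_def G \<and> transpose J ** G ** J = G \<and>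
             G ** mcosh K = transpose (mcosh K) ** G \<and> pos_def (G ** mcosh K)"
proof (cases "bosonic_cs J \<and> K \<in> u_perp sp_alg J")
  case True
  note H = bosonic_metric[OF conjunct1[OF True] conjunct2[OF True]]
  show ?thesis
    using H(1,2) mcosh_adjoint[OF H(3)] pos_def_mult_mcosh[OF H(1,3)] by blast
next
  case False
  then have "fermionic_cs J" and "K \<in> I_u_perp so_alg J"
    using assms by auto
  then have "transpose J ** mat 1 ** J = mat 1" and skew: "transpose K = - K"
    and small: "\<forall>c\<in>eigenvalues K. cmod c < pi / 2"
    by (auto simp: fermionic_cs_def I_u_perp_def u_perp_def so_alg_def)
  moreover have "pos_def (mcosh K)"
    using skew small by (rule pos_def_mcosh_skew)
  moreover have "pos_def (mat 1)"
    by (simp add: pos_def_def)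
  ultimately show ?thesis
    by (intro exI[of _ "mat 1"]) (simp add: mcosh_transpose mcosh_uminus skew)
qed

theorem lemma6:
  fixes J K :: "'n::finite rmat2"
  assumes "(bosonic_cs J \<and> K \<in> u_perp sp_alg J) \<or> (fermionic_cs J \<and> K \<in> I_u_perp so_alg J)"
  shows "mcosh K ** J = J ** mcosh K \<and>
         detbar J (mcosh K) = complex_of_real (sqrt (det (mcosh K))) \<and>
         sqrt (det (mcosh K)) > 0"
proof -
  have JJ: "J ** J = - mat 1"
    using assms by (auto simp: bosonic_cs_def fermionic_cs_def)
  have CJ: "mcosh K ** J = J ** mcosh K"
    using assms by (intro mcosh_commute_if_anticommute) (auto simp: u_perp_def I_u_perp_def)
  obtain G where "pos_def G" "transpose J ** G ** J = G"
    and "G ** mcosh K = transpose (mcosh K) ** G" "pos_def (G ** mcosh K)"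
    using mcosh_positive_for_invariant_metric[OF assms] by blast
  then obtain r where "r > 0" "detbar J (mcosh K) = complex_of_real r" "det (mcosh K) = r\<^sup>2"
    using detbar_pos[OF JJ _ _ CJ] by blast
  then show ?thesis
    using CJ by simp
qed

end
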